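(* Let $G$ be a virtually cyclic group generated by a finite symmetric set $X$. Then either the geodesic growth function $\Gamma_{G,X}$ is bounded above and below by exponential functions (there exist constants $1<b\le B$ with $b^n\le\Gamma_{G,X}(n)\le B^n$ for all $n$), or $\Gamma_{G,X}$ is bounded above and below by polynomials of the same degree.
   Context: Generating sets may contain repeated elements: formally a finite symmetric generating set is a finite symmetric alphabet $X$ with an epimorphism from the free monoid on $X$ onto $G$ (symmetric: each letter has a letter mapping to its inverse). A word over $X$ is a geodesic if its length equals the word length of the element it represents. The geodesic growth function $\Gamma_{G,X}(n)$ is the number of geodesic words over $X$ of length at most $n$. *)

theory Defs
  imports "HOL-Algebra.Coset" "HOL-Algebra.Generated_Groups" "HOL-Computational_Algebra.Polynomial"
begin

definition word_eval :: "('a, 'b) monoid_scheme \<Rightarrow> ('x \<Rightarrow> 'a) \<Rightarrow> 'x list \<Rightarrow> 'a" where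
  "word_eval G ev w = foldr (\<lambda>x acc. monoid.mult G (ev x) acc) w (one G)"

definition fin_sym_gen_set :: "('a, 'b) monoid_scheme \<Rightarrow> 'x set \<Rightarrow> ('x \<Rightarrow> 'a) \<Rightarrow> bool" where
  "fin_sym_gen_set G X ev \<longleftrightarrow> finite X \<and> ev ` X \<subseteq> carrier G
     \<and> (\<forall>g\<in>carrier G. \<exists>w\<in>lists X. word_eval G ev w = g)
     \<and> (\<forall>x\<in>X. \<exists>y\<in>X. ev y = Group.m_inv G (ev x))"

definition word_length :: "('a, 'b) monoid_scheme \<Rightarrow> 'x set \<Rightarrow> ('x \<Rightarrow> 'a) \<Rightarrow> 'a \<Rightarrow> nat" where
  "word_length G X ev g = (LEAST n. \<exists>w\<in>lists X. length w = n \<and> word_eval G ev w = g)"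

definition geodesic :: "('a, 'b) monoid_scheme \<Rightarrow> 'x set \<Rightarrow> ('x \<Rightarrow> 'a) \<Rightarrow> 'x list \<Rightarrow> bool" where
  "geodesic G X ev w \<longleftrightarrow> w \<in> lists X \<and> length w = word_length G X ev (word_eval G ev w)"

definition geodesic_growth :: "('a, 'b) monoid_scheme \<Rightarrow> 'x set \<Rightarrow> ('x \<Rightarrow> 'a) \<Rightarrow> nat \<Rightarrow> nat" where
  "geodesic_growth G X ev n = card {w. geodesic G X ev w \<and> length w \<le> n}"

definition virtually_cyclic :: "('a, 'b) monoid_scheme \<Rightarrow> bool" where
  "virtually_cyclic G \<longleftrightarrow> (\<exists>h\<in>carrier G. finite (RCOSETS G (generate G {h})))"

end

(* Geodesics of a virtually cyclic group fellow-travel: a geodesic moves along the axis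
   of an infinite cyclic subgroup by bounded jumps, hence passes close to every power t^k between
   its ends, and this makes the length of t^k superadditive up to a constant on each half of the
   axis. By Cannon's argument the geodesic language then has finitely many left quotients (cone
   types). For a prefix-closed language of this kind, either some quotient returns to itself along
   two non-commuting words, and the growth is exponential, or all loops at a quotient are
   essentially powers of a single word, and each loop passed raises the degree of polynomial growth
   by one. Finally, factors of geodesics are geodesic, so the growth function is submultiplicative,
   which turns c * b^n <= f n into b^n <= f n. *)
theory Submission
  imports Defs "HOL-Library.Sublist"
begin

section \<open>Polynomial and exponential growth\<close>

text \<open>The base is \<open>n + 1\<close> rather than \<open>n\<close> so that a positive value
  at \<open>n = 0\<close> is compatible with the upper bound for every degree.\<close>

definition poly_growth :: "nat \<Rightarrow> (nat \<Rightarrow> nat) \<Rightarrow> bool" where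
  "poly_growth d f \<longleftrightarrow>
     (\<exists>c::real. c > 0 \<and> (\<forall>n. c * real (n + 1) ^ d \<le> real (f n))) \<and>
     (\<exists>K::real. \<forall>n. real (f n) \<le> K * real (n + 1) ^ d)"

definition exp_growth :: "(nat \<Rightarrow> nat) \<Rightarrow> bool" where
  "exp_growth f \<longleftrightarrow> (\<exists>c b::real. c > 0 \<and> b > 1 \<and> (\<forall>n. c * b ^ n \<le> real (f n)))"

section \<open>Sums of functions of polynomial growth\<close>

lemma poly_growth_one: "poly_growth 0 (\<lambda>_. 1)"
  unfolding poly_growth_def by (auto intro!: exI[of _ 1])

lemma poly_growth_bounds:
  assumes "poly_growth d f"
  obtains c K :: real where "c > 0" "K > 0" "\<And>n. c * real (n + 1) ^ d \<le> real (f n)"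
    "\<And>n. real (f n) \<le> K * real (n + 1) ^ d"
proof -
  obtain c K :: real where c: "c > 0" "\<And>n. c * real (n + 1) ^ d \<le> real (f n)"
    and K: "\<And>n. real (f n) \<le> K * real (n + 1) ^ d"
    using assms unfolding poly_growth_def by blast
  have "c \<le> K" using c(2)[of 0] K[of 0] by simp
  with c K that show thesis by (meson less_le_trans)
qed

lemma poly_growth_add_le:
  assumes "poly_growth d f" "poly_growth e g" "d \<le> e"
  shows "poly_growth e (\<lambda>n. f n + g n)"
proof -
  obtain c K :: real where f: "c > 0" "K > 0" "\<And>n. c * real (n + 1) ^ d \<le> real (f n)"
    "\<And>n. real (f n) \<le> K * real (n + 1) ^ d" using assms(1) by (rule poly_growth_bounds) blast
  obtain c' K' :: real where g: "c' > 0" "K' > 0" "\<And>n. c' * real (n + 1) ^ e \<le> real (g n)"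
    "\<And>n. real (g n) \<le> K' * real (n + 1) ^ e" using assms(2) by (rule poly_growth_bounds) blast
  have "c' * real (n + 1) ^ e \<le> real (f n + g n)" for n
    using g(3)[of n] by simp
  moreover have "real (f n + g n) \<le> (K + K') * real (n + 1) ^ e" for n
  proof -
    have "K * real (n + 1) ^ d \<le> K * real (n + 1) ^ e"
      using assms(3) f(2) by (intro mult_left_mono power_increasing) auto
    then show ?thesis using f(4)[of n] g(4)[of n] by (simp add: ring_distribs)
  qed
  ultimately show ?thesis unfolding poly_growth_def using g(1) by blast
qed

lemma poly_growth_add:
  assumes "poly_growth d f" "poly_growth e g"
  shows "\<exists>k. poly_growth k (\<lambda>n. f n + g n)"
proof (cases "d \<le> e")
  case False
  then show ?thesis using poly_growth_add_le[OF assms(2,1)] by (auto simp: add.commute)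
qed (use poly_growth_add_le[OF assms] in blast)

text \<open>The summand 1 will stand for the empty word; it also gives degree 0 when
  \<open>A\<close> is empty.\<close>

lemma poly_growth_Suc_sum:
  assumes "finite A" "\<And>q. q \<in> A \<Longrightarrow> \<exists>d. poly_growth d (h q)"
  shows "\<exists>d. poly_growth d (\<lambda>n. 1 + (\<Sum>q\<in>A. h q n))"
  using assms
proof (induction A)
  case empty
  then show ?case using poly_growth_one by auto
next
  case (insert q A)
  then obtain d e where "poly_growth d (\<lambda>n. 1 + (\<Sum>q\<in>A. h q n))" "poly_growth e (h q)"
    by blast
  from poly_growth_add[OF this(2,1)] show ?case
    using insert.hyps by (simp add: add.left_commute)
qed

text \<open>For \<open>n \<ge> 1\<close> the shift by one costs only the factor
  \<open>2 ^ d\<close>, since \<open>n + 1 \<le> 2 * n\<close>; the value at 0 is covered by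
  \<open>f 0 > 0\<close>.\<close>

lemma poly_growth_shift:
  assumes S: "poly_growth d S" and pos: "f 0 > 0"
    and lower: "\<And>n. S n \<le> f (n + 1)" and upper: "\<And>n. f n \<le> S n"
  shows "poly_growth d f"
proof -
  obtain c K :: real where c: "c > 0" "\<And>n. c * real (n + 1) ^ d \<le> real (S n)"
    and K: "\<And>n. real (S n) \<le> K * real (n + 1) ^ d" using S by (rule poly_growth_bounds) blast
  define c' where "c' = min 1 (c / 2 ^ d)"
  have c': "c' > 0" "c' \<le> 1" "c' * 2 ^ d \<le> c" using c(1) by (auto simp: c'_def min_def field_simps)
  have "c' * real (n + 1) ^ d \<le> real (f n)" for n
  proof (cases n)
    case 0
    then show ?thesis using c' pos by simp
  next
    case (Suc m)
    have "c' * real (n + 1) ^ d \<le> c' * (2 * real (m + 1)) ^ d"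
      using c'(1) Suc by (intro mult_left_mono power_mono) auto
    also have "\<dots> = (c' * 2 ^ d) * real (m + 1) ^ d" by (simp only: power_mult_distrib mult.assoc)
    also have "\<dots> \<le> c * real (m + 1) ^ d" using c'(3) by (intro mult_right_mono) auto
    also have "\<dots> \<le> real (f n)" using c(2)[of m] lower[of m] Suc by simp
    finally show ?thesis .
  qed
  moreover have "real (f n) \<le> K * real (n + 1) ^ d" for n
    using K[of n] upper[of n] by simp
  ultimately show ?thesis unfolding poly_growth_def using c'(1) by blast
qed

lemma power_shift_le:
  fixes l :: real
  assumes "l \<ge> 0"
  shows "\<exists>A\<ge>0. \<forall>x\<ge>1. (x + l) ^ Suc d \<le> x ^ Suc d + A * x ^ d"
proof (induction d)
  case 0
  then show ?case using assms by auto
next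
  case (Suc d)
  then obtain A where A: "A \<ge> 0" "\<And>x. x \<ge> 1 \<Longrightarrow> (x + l) ^ Suc d \<le> x ^ Suc d + A * x ^ d" by blast
  have "(x + l) ^ Suc (Suc d) \<le> x ^ Suc (Suc d) + (A + l + A * l) * x ^ Suc d" if "x \<ge> 1" for x
  proof -
    have "(x + l) ^ Suc (Suc d) \<le> (x + l) * (x ^ Suc d + A * x ^ d)"
      using A(2)[OF that] that assms by (simp only: power_Suc[of _ "Suc d"]) (intro mult_left_mono, auto)
    also have "\<dots> = x ^ Suc (Suc d) + (A + l) * x ^ Suc d + A * l * x ^ d" by (simp add: algebra_simps)
    also have "A * l * x ^ d \<le> A * l * x ^ Suc d"
      using A(1) assms that by (intro mult_left_mono power_increasing) auto
    finally show ?thesis by (simp add: algebra_simps)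
  qed
  moreover have "A + l + A * l \<ge> 0" using A(1) assms by simp
  ultimately show ?case by blast
qed

text \<open>Discrete integration: over each step of length \<open>l\<close> the gain of
  \<open>f\<close> is comparable to \<open>S\<close>, which has degree \<open>d\<close>, so
  \<open>f\<close> has degree \<open>d + 1\<close>.\<close>

lemma poly_growth_integrate:
  assumes S: "poly_growth d S" and pos: "f 0 > 0" and "mono f" and l: "l > 0"
    and lower: "\<And>n. f n + S n \<le> f (n + l)" and upper: "\<And>n. f (n + l) \<le> f n + s * S (n + l)"
  shows "poly_growth (Suc d) f"
proof -
  obtain c K :: real where c: "c > 0" "\<And>n. c * real (n + 1) ^ d \<le> real (S n)"
    and K: "K > 0" "\<And>n. real (S n) \<le> K * real (n + 1) ^ d" using S by (rule poly_growth_bounds) blast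
  obtain A :: real where A: "A \<ge> 0"
    "\<And>x. x \<ge> 1 \<Longrightarrow> (x + real l) ^ Suc d \<le> x ^ Suc d + A * x ^ d"
    using power_shift_le[of "real l" d] by auto
  \<comment> \<open>The first bound settles \<open>n < l\<close>, where \<open>f n \<ge> 1\<close>.
    The second makes the gain of \<open>f\<close>, at least \<open>c * x ^ d\<close>, cover the gain
    of \<open>c' * x ^ Suc d\<close>, at most \<open>c' * A * x ^ d\<close>.\<close>
  define c' where "c' = min (1 / real l ^ Suc d) (c / (A + 1))"
  have c': "c' > 0" "c' * real l ^ Suc d \<le> 1" "c' * A \<le> c"
  proof -
    show "c' > 0" using c(1) A(1) l by (auto simp: c'_def)
    have "c' \<le> 1 / real l ^ Suc d" by (simp add: c'_def)
    then show "c' * real l ^ Suc d \<le> 1" using l by (simp add: field_simps)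
    have "c' \<le> c / (A + 1)" by (simp add: c'_def)
    then have "c' * (A + 1) \<le> c" using A(1) by (simp add: field_simps)
    then show "c' * A \<le> c" using \<open>c' > 0\<close> by (simp add: algebra_simps)
  qed
  \<comment> \<open>\<open>f l\<close> dominates \<open>f\<close> on the initial range; the other
    summand bounds each later gain, because \<open>x + l \<le> (l + 1) * x\<close> for
    \<open>x \<ge> 1\<close>.\<close>
  define K' where "K' = real (f l) + real s * K * real (l + 1) ^ d"
  have f_pos: "f n > 0" for n using pos monoD[OF \<open>mono f\<close>, of 0 n] by simp
  have "c' * real (n + 1) ^ Suc d \<le> real (f n) \<and> real (f n) \<le> K' * real (n + 1) ^ Suc d" for n
  proof (induction n rule: less_induct)
    case (less n)
    show ?case
    proof (cases "n < l")
      case True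
      have "c' * real (n + 1) ^ Suc d \<le> c' * real l ^ Suc d"
        using True c'(1) by (intro mult_left_mono power_mono) auto
      also have "\<dots> \<le> real (f n)" using c'(2) f_pos[of n] by linarith
      finally have 1: "c' * real (n + 1) ^ Suc d \<le> real (f n)" .
      have "real (f n) \<le> real (f l)" using monoD[OF \<open>mono f\<close>, of n l] True by simp
      also have "\<dots> \<le> K' * 1" using K(1) by (simp add: K'_def)
      also have "\<dots> \<le> K' * real (n + 1) ^ Suc d"
        using K(1) by (intro mult_left_mono one_le_power) (auto simp: K'_def)
      finally show ?thesis using 1 by simp
    next
      case False
      then obtain m where m: "n = m + l" by (metis add.commute le_add_diff_inverse not_less)
      define x where "x = real (m + 1)"
      have x: "x \<ge> 1" "real (n + 1) = x + real l" by (auto simp: x_def m)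
      have IH: "c' * x ^ Suc d \<le> real (f m)" "real (f m) \<le> K' * x ^ Suc d"
        using less.IH[of m] m l by (auto simp: x_def)
      have "c' * real (n + 1) ^ Suc d \<le> c' * (x ^ Suc d + A * x ^ d)"
        unfolding x(2) using A(2)[OF x(1)] c'(1) by (intro mult_left_mono) auto
      also have "\<dots> = c' * x ^ Suc d + (c' * A) * x ^ d" by (simp add: algebra_simps)
      also have "\<dots> \<le> real (f m) + c * x ^ d"
        using c'(3) IH(1) x(1) by (intro add_mono mult_right_mono) auto
      also have "\<dots> \<le> real (f n)" using c(2)[of m] lower[of m] unfolding m x_def by linarith
      finally have 1: "c' * real (n + 1) ^ Suc d \<le> real (f n)" .
      have "real (S n) \<le> K * (x + real l) ^ d" using K(2)[of n] x(2) by simp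
      also have "\<dots> \<le> K * (real (l + 1) * x) ^ d"
      proof (intro mult_left_mono power_mono)
        have "real l * 1 \<le> real l * x" using x(1) by (intro mult_left_mono) auto
        then show "x + real l \<le> real (l + 1) * x" by (simp add: algebra_simps)
      qed (use K(1) x(1) in auto)
      finally have "real s * real (S n) \<le> real s * (K * (real (l + 1) * x) ^ d)"
        by (intro mult_left_mono) auto
      also have "\<dots> = (real s * K * real (l + 1) ^ d) * x ^ d"
        by (simp only: power_mult_distrib ac_simps)
      also have "\<dots> \<le> K' * x ^ d" using x(1) by (intro mult_right_mono) (auto simp: K'_def)
      finally have "real s * real (S n) \<le> K' * x ^ d" .
      moreover have "real (f n) \<le> real (f m) + real s * real (S n)"
        using upper[of m] unfolding m by (metis of_nat_add of_nat_mult of_nat_le_iff)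
      ultimately have "real (f n) \<le> K' * x ^ Suc d + K' * x ^ d" using IH(2) by linarith
      also have "\<dots> = K' * (x ^ d * (x + 1))" by (simp add: algebra_simps)
      also have "\<dots> \<le> K' * ((x + real l) ^ d * (x + real l))"
        using K(1) x(1) l by (intro mult_left_mono mult_mono power_mono) (auto simp: K'_def)
      finally show ?thesis using 1 x(2) by (simp add: mult.commute)
    qed
  qed
  then show ?thesis unfolding poly_growth_def using c'(1) by blast
qed

lemma exp_growth_shift:
  assumes "exp_growth g" "\<And>n. g n \<le> f (n + k)" "\<And>n. f n > 0"
  shows "exp_growth f"
proof -
  obtain c b :: real where c: "c > 0" "b > 1" "\<And>n. c * b ^ n \<le> real (g n)"
    using assms(1) unfolding exp_growth_def by blast
  define c' where "c' = min 1 c / b ^ k"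
  have c': "c' > 0" "c' * b ^ k \<le> 1" "c' * b ^ k \<le> c" using c(1,2) by (auto simp: c'_def)
  have "c' * b ^ n \<le> real (f n)" for n
  proof (cases "n \<le> k")
    case True
    have "c' * b ^ n \<le> c' * b ^ k" using True c c' by (intro mult_left_mono power_increasing) auto
    also have "\<dots> \<le> real (f n)" using c'(2) assms(3)[of n] by linarith
    finally show ?thesis .
  next
    case False
    then obtain m where m: "n = m + k" by (metis add.commute le_add_diff_inverse nat_le_linear)
    have "c' * b ^ n = (c' * b ^ k) * b ^ m" by (simp add: m power_add)
    also have "\<dots> \<le> c * b ^ m" using c'(3) c(2) by (intro mult_right_mono) auto
    also have "\<dots> \<le> real (f n)" using c(3)[of m] assms(2)[of m] m
      by (metis of_nat_le_iff order_trans)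
    finally show ?thesis .
  qed
  then show ?thesis unfolding exp_growth_def using c' c(2) by blast
qed

text \<open>Doubling over every \<open>k\<close> steps gives the rate \<open>root k 2\<close>; the
  factor 1/2 pays for an incomplete block of fewer than \<open>k\<close> steps.\<close>

lemma exp_growth_doubling:
  assumes "\<And>n. 2 * f n \<le> f (n + k)" "\<And>n. f n > 0" "mono f"
  shows "exp_growth f"
proof -
  have k: "k > 0" using assms(1)[of 0] assms(2)[of 0] by (cases k) auto
  define b where "b = root k 2"
  have b: "b > 1" "b ^ k = 2" using k by (auto simp: b_def real_root_gt_1_iff)
  have "b ^ n \<le> 2 * real (f n)" for n
  proof (induction n rule: less_induct)
    case (less n)
    show ?case
    proof (cases "n < k")
      case True
      have "b ^ n \<le> b ^ k" using True b by (intro power_increasing) auto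
      also have "\<dots> \<le> 2 * real (f n)" using b(2) assms(2)[of n] by linarith
      finally show ?thesis .
    next
      case False
      then obtain m where m: "n = m + k" by (metis add.commute le_add_diff_inverse not_less)
      have "b ^ n = 2 * b ^ m" by (simp add: m power_add b)
      also have "\<dots> \<le> 2 * (2 * real (f m))" using less.IH[of m] m k by simp
      also have "\<dots> \<le> 2 * real (f n)" using assms(1)[of m] unfolding m
        by (metis (mono_tags) of_nat_mult of_nat_numeral of_nat_le_iff mult_left_mono zero_le_numeral)
      finally show ?thesis .
    qed
  qed
  then have "1/2 * b ^ n \<le> real (f n)" for n by (simp add: field_simps)
  then show ?thesis unfolding exp_growth_def using b(1) by (intro exI[of _ "1/2"] exI[of _ b]) simp
qed

section \<open>Languages with finitely many left quotients\<close>

text \<open>For the language of geodesics, the left quotient by a geodesic \<open>w\<close> is the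
  cone type of the element it represents.\<close>

definition left_quot :: "'x list set \<Rightarrow> 'x list \<Rightarrow> 'x list set" where
  "left_quot C u = {v. u @ v \<in> C}"

definition left_quots :: "'x list set \<Rightarrow> 'x list set set" where
  "left_quots C = left_quot C ` C"

definition prefix_closed :: "'x list set \<Rightarrow> bool" where
  "prefix_closed C \<longleftrightarrow> [] \<in> C \<and> (\<forall>u v. u @ v \<in> C \<longrightarrow> u \<in> C)"

definition growth :: "'x list set \<Rightarrow> nat \<Rightarrow> nat" where
  "growth C n = card {w \<in> C. length w \<le> n}"

lemma left_quot_Nil [simp]: "left_quot C [] = C"
  by (simp add: left_quot_def)

lemma left_quot_left_quot: "left_quot (left_quot C u) v = left_quot C (u @ v)"
  by (simp add: left_quot_def)

lemma prefix_closed_left_quot: "prefix_closed C \<Longrightarrow> u \<in> C \<Longrightarrow> prefix_closed (left_quot C u)"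
  unfolding prefix_closed_def left_quot_def by (metis append_Nil2 append_assoc mem_Collect_eq)

text \<open>A quotient of a quotient is again a quotient of \<open>C\<close>; this is what allows
  induction on their number.\<close>

lemma left_quots_left_quot: "left_quots (left_quot C u) \<subseteq> left_quots C"
  by (auto simp: left_quots_def left_quot_left_quot intro!: imageI) (simp add: left_quot_def)

lemma left_quot_lists: "C \<subseteq> lists X \<Longrightarrow> left_quot C u \<subseteq> lists X"
  unfolding left_quot_def by auto

section \<open>Counting words by their prefixes\<close>

lemma finite_short_words:
  assumes "finite X" "C \<subseteq> lists X"
  shows "finite {w \<in> C. length w \<le> n}"
  by (rule finite_subset[OF _ finite_lists_length_le[OF assms(1)]]) (use assms(2) in auto)

lemma mono_growth: "finite X \<Longrightarrow> C \<subseteq> lists X \<Longrightarrow> mono (growth C)"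
  unfolding growth_def by (intro monoI card_mono finite_short_words) auto

lemma growth_pos:
  assumes "finite X" "C \<subseteq> lists X" "prefix_closed C"
  shows "growth C n > 0"
  using assms finite_short_words[OF assms(1,2)]
  by (auto simp: growth_def card_gt_0_iff prefix_closed_def intro!: exI[of _ "[]"])

text \<open>Pairwise incomparable words in the prefix order head disjoint families of words.\<close>

lemma sum_growth_le:
  fixes C :: "'x list set"
  assumes X: "finite X" "C \<subseteq> lists X" and C: "prefix_closed C"
    and A: "finite A" "[] \<notin> A" "\<And>q. q \<in> A \<Longrightarrow> length q \<le> k"
    and anti: "\<And>p q. p \<in> A \<Longrightarrow> q \<in> A \<Longrightarrow> prefix p q \<Longrightarrow> p = q"
  shows "1 + (\<Sum>q\<in>A. growth (left_quot C q) n) \<le> growth C (n + k)"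
proof -
  let ?W = "\<lambda>q. (@) q ` {v \<in> left_quot C q. length v \<le> n}"
  have fin: "finite {v \<in> left_quot C q. length v \<le> n}" for q
    using X by (intro finite_short_words[of X] left_quot_lists)
  \<comment> \<open>Two prefixes of one word are comparable, so a common element would contradict
    \<open>anti\<close>.\<close>
  have disj: "?W p \<inter> ?W q = {}" if "p \<in> A" "q \<in> A" "p \<noteq> q" for p q
  proof -
    have "\<not> prefix p q" "\<not> prefix q p" using anti that by blast+
    then show ?thesis
      by (auto dest!: prefix_same_cases[of p _ q] simp: append_eq_append_conv2)
  qed
  have "1 + (\<Sum>q\<in>A. growth (left_quot C q) n) = 1 + (\<Sum>q\<in>A. card (?W q))"
    unfolding growth_def by (simp add: card_image inj_on_def)
  also have "\<dots> = card {[] :: 'x list} + card (\<Union>q\<in>A. ?W q)"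
    using A(1) fin disj by (subst card_UN_disjoint) auto
  also have "\<dots> = card ({[]} \<union> (\<Union>q\<in>A. ?W q))"
    using A(1,2) fin by (intro card_Un_disjoint[symmetric]) auto
  also have "\<dots> \<le> growth C (n + k)"
    unfolding growth_def
  proof (intro card_mono finite_short_words[OF X] subsetI)
    fix w assume "w \<in> {[]} \<union> (\<Union>q\<in>A. ?W q)"
    then show "w \<in> {w \<in> C. length w \<le> n + k}"
      using C A(3) by (fastforce simp: prefix_closed_def left_quot_def add.commute intro: add_mono)
  qed
  finally show ?thesis .
qed

text \<open>Union bound, the converse of \<open>sum_growth_le\<close>: a word outside
  \<open>F\<close> is given by a prefix from \<open>A\<close> and the remaining word. If
  \<open>length q > n\<close>, the truncated difference only enlarges the bound.\<close>

lemma growth_le_sum: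
  assumes X: "finite X" "C \<subseteq> lists X" and A: "finite A" and F: "finite F"
    and cover: "\<And>w. w \<in> C \<Longrightarrow> w \<in> F \<or> (\<exists>q\<in>A. prefix q w)"
  shows "growth C n \<le> card F + (\<Sum>q\<in>A. growth (left_quot C q) (n - length q))"
proof -
  let ?W = "\<lambda>q. (@) q ` {v \<in> left_quot C q. length v \<le> n - length q}"
  have fin: "finite {v \<in> left_quot C q. length v \<le> m}" for q m
    using X by (intro finite_short_words[of X] left_quot_lists)
  have "growth C n \<le> card (F \<union> (\<Union>q\<in>A. ?W q))"
    unfolding growth_def
  proof (intro card_mono subsetI)
    show "finite (F \<union> (\<Union>q\<in>A. ?W q))" using A F fin by auto
    fix w assume "w \<in> {w \<in> C. length w \<le> n}"
    with cover[of w] show "w \<in> F \<union> (\<Union>q\<in>A. ?W q)"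
      by (fastforce simp: prefix_def left_quot_def)
  qed
  also have "\<dots> \<le> card F + card (\<Union>q\<in>A. ?W q)" by (rule card_Un_le)
  also have "card (\<Union>q\<in>A. ?W q) \<le> (\<Sum>q\<in>A. card (?W q))" using A by (rule card_UN_le)
  also have "\<dots> = (\<Sum>q\<in>A. growth (left_quot C q) (n - length q))"
    unfolding growth_def by (simp add: card_image inj_on_def)
  finally show ?thesis by simp
qed

lemma growth_left_quot_le:
  assumes "finite X" "C \<subseteq> lists X"
  shows "growth (left_quot C u) n \<le> growth C (n + length u)"
proof -
  have "growth (left_quot C u) n = card ((@) u ` {v \<in> left_quot C u. length v \<le> n})"
    unfolding growth_def by (simp add: card_image inj_on_def)
  also have "\<dots> \<le> growth C (n + length u)"
    unfolding growth_def
    by (intro card_mono finite_short_words[OF assms]) (auto simp: left_quot_def)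
  finally show ?thesis .
qed

text \<open>Induction on the number of left quotients. If \<open>C\<close> is a left quotient of itself along
  two non-commuting words, words can be continued in two independent ways; if it is so along
  essentially one word \<open>u\<close> only, a word of \<open>C\<close> runs along \<open>u\<close> for a while and then
  leaves it through one of finitely many exits, whose quotients never lead back to \<open>C\<close>.\<close>

theorem growth_dichotomy:
  fixes C :: "'x list set"
  assumes X: "finite X" and "C \<subseteq> lists X" "prefix_closed C" "finite (left_quots C)"
  shows "exp_growth (growth C) \<or> (\<exists>d. poly_growth d (growth C))"
  using assms(2-)
proof (induction "card (left_quots C)" arbitrary: C rule: less_induct)
  case less
  note CX = less.prems(1) and C = less.prems(2) and fin = less.prems(3)
  have pos: "growth C n > 0" for n using growth_pos[OF X CX C] .
  have mono: "mono (growth C)" using mono_growth[OF X CX] .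
  have C_quot: "C \<in> left_quots C"
    using C unfolding left_quots_def prefix_closed_def by (metis imageI left_quot_Nil)
  show ?case
  proof (cases "exp_growth (growth C)")
    case not_exp: False
    \<comment> \<open>If no continuation of \<open>u\<close> leads back to \<open>C\<close>, the
      quotient by \<open>u\<close> has lost \<open>C\<close> among its own quotients, so the
      induction hypothesis applies. Exponential growth there would carry over to
      \<open>C\<close>.\<close>
    have exit: "\<exists>d. poly_growth d (growth (left_quot C u))"
      if u: "u \<in> C" and no_return: "\<And>v. u @ v \<in> C \<Longrightarrow> left_quot C (u @ v) \<noteq> C" for u
    proof -
      have "C \<notin> left_quots (left_quot C u)"
        using no_return by (auto simp: left_quots_def left_quot_left_quot left_quot_def)
      then have "left_quots (left_quot C u) \<subset> left_quots C"
        using left_quots_left_quot[of C u] C_quot by auto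
      then have "card (left_quots (left_quot C u)) < card (left_quots C)"
        and "finite (left_quots (left_quot C u))"
        using fin by (auto intro: psubset_card_mono finite_subset)
      then have "exp_growth (growth (left_quot C u)) \<or> (\<exists>d. poly_growth d (growth (left_quot C u)))"
        using less.hyps left_quot_lists[OF CX] prefix_closed_left_quot[OF C u] by blast
      moreover have "\<not> exp_growth (growth (left_quot C u))"
        using not_exp exp_growth_shift[of _ "growth C" "length u"] growth_left_quot_le[OF X CX] pos by blast
      ultimately show ?thesis by blast
    qed
    show ?thesis
    proof (cases "\<exists>u\<in>C. u \<noteq> [] \<and> left_quot C u = C")
      \<comment> \<open>Every one-letter quotient is an exit here, and the growth of
        \<open>C\<close> is their sum plus 1, up to a shift by one.\<close>
      case False
      define A where "A = {[x] | x. [x] \<in> C}"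
      define S where "S n = 1 + (\<Sum>q\<in>A. growth (left_quot C q) n)" for n
      have A: "finite A"
        by (rule finite_subset[of _ "(\<lambda>x. [x]) ` X"]) (use CX X in \<open>auto simp: A_def\<close>)
      have "\<exists>d. poly_growth d (growth (left_quot C q))" if "q \<in> A" for q
        using that False by (intro exit) (auto simp: A_def)
      then obtain d where d: "poly_growth d S"
        using poly_growth_Suc_sum[OF A, of "\<lambda>q. growth (left_quot C q)"] by (auto simp: S_def[abs_def])
      have lower: "S n \<le> growth C (n + 1)" for n
        unfolding S_def by (rule sum_growth_le[OF X CX C A]) (auto simp: A_def)
      have upper: "growth C n \<le> S n" for n
      proof -
        have "growth C n \<le> card {[] :: 'x list} + (\<Sum>q\<in>A. growth (left_quot C q) (n - length q))"
        proof (rule growth_le_sum[OF X CX A])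
          fix w assume "w \<in> C"
          then show "w \<in> {[]} \<or> (\<exists>q\<in>A. prefix q w)"
            using C by (cases w) (auto simp: A_def prefix_closed_def prefix_def, metis append_Cons append_Nil)
        qed simp
        also have "\<dots> \<le> S n"
          unfolding S_def
          using monoD[OF mono_growth[OF X left_quot_lists[OF CX]]] by (simp add: sum_mono)
        finally show ?thesis .
      qed
      from poly_growth_shift[OF d pos lower upper] show ?thesis by blast
    next
      case True
      then obtain u where u: "u \<in> C" "u \<noteq> []" "left_quot C u = C" by blast
      \<comment> \<open>Otherwise \<open>u @ v\<close> and \<open>v @ u\<close> are distinct words
        of equal length, hence incomparable, and both return to \<open>C\<close>; the growth would
        double over that length.\<close>
      have commute: "u @ v = v @ u" if "v \<in> C" "left_quot C v = C" for v
      proof (rule ccontr)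
        assume ne: "u @ v \<noteq> v @ u"
        have quot: "left_quot C (u @ v) = C" "left_quot C (v @ u) = C"
          using u that by (simp_all add: left_quot_left_quot[symmetric])
        have "2 * growth C n \<le> growth C (n + length (u @ v))" for n
        proof -
          have "1 + (\<Sum>q\<in>{u @ v, v @ u}. growth (left_quot C q) n) \<le> growth C (n + length (u @ v))"
            by (rule sum_growth_le[OF X CX C]) (use u in \<open>auto simp: prefix_def dest: arg_cong[of _ _ length]\<close>)
          then show ?thesis using ne quot by simp
        qed
        then show False using not_exp exp_growth_doubling[of "growth C"] pos mono by blast
      qed
      \<comment> \<open>\<open>Q\<close> consists of the exits from \<open>u\<close>: words that
        follow \<open>u\<close> up to their last letter and deviate there. \<open>F\<close> collects
        the words that stop before completing \<open>u\<close>.\<close>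
      define Q where "Q = {q \<in> C. q \<noteq> [] \<and> strict_prefix (butlast q) u \<and> \<not> prefix q u}"
      define F where "F = {w. strict_prefix w u}"
      define S where "S n = 1 + (\<Sum>q\<in>Q. growth (left_quot C q) n)" for n
      have lenQ: "length q \<le> length u" if "q \<in> Q" for q
        using that prefix_length_less[of "butlast q" u] by (auto simp: Q_def)
      have Q: "finite Q"
        by (rule finite_subset[OF _ finite_short_words[OF X CX, of "length u"]])
          (use lenQ in \<open>auto simp: Q_def\<close>)
      have F: "finite F" "[] \<in> F"
        using u(2) by (auto simp: F_def strict_prefix_def intro!: finite_subset[of _ "set (prefixes u)"])
      then have cardF: "card F > 0" by (auto simp: card_gt_0_iff)
      have "\<exists>d. poly_growth d (growth (left_quot C q))" if q: "q \<in> Q" for q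
      proof (rule exit)
        show "q \<in> C" using q by (simp add: Q_def)
        fix v assume "q @ v \<in> C"
        show "left_quot C (q @ v) \<noteq> C"
        proof
          assume "left_quot C (q @ v) = C"
          \<comment> \<open>The return word commutes with \<open>u\<close>, so \<open>u\<close> and
            \<open>q\<close> are prefixes of the same word; being no longer than \<open>u\<close>,
            the exit \<open>q\<close> would be a prefix of \<open>u\<close>.\<close>
          then have "u @ q @ v = q @ v @ u" using commute \<open>q @ v \<in> C\<close> by fastforce
          then have "prefix q u" using lenQ[OF q]
            by (metis prefixI prefix_length_prefix)
          then show False using q by (simp add: Q_def)
        qed
      qed
      then obtain d where d: "poly_growth d S"
        using poly_growth_Suc_sum[OF Q, of "\<lambda>q. growth (left_quot C q)"] by (auto simp: S_def[abs_def])
      have lower: "growth C n + S n \<le> growth C (n + length u)" for n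
      proof -
        have "1 + (\<Sum>q\<in>insert u Q. growth (left_quot C q) n) \<le> growth C (n + length u)"
        proof (rule sum_growth_le[OF X CX C])
          fix p q assume pq: "p \<in> insert u Q" "q \<in> insert u Q" "prefix p q"
          show "p = q"
          proof (rule ccontr)
            assume "p \<noteq> q"
            \<comment> \<open>A proper prefix of \<open>q\<close> is a prefix of
              \<open>butlast q\<close>, hence of \<open>u\<close>. No exit is one, so
              \<open>p\<close> is \<open>u\<close>, and then \<open>q\<close> would be too
              long.\<close>
            then have "prefix p (butlast q)" using pq(3)
              by (metis append_butlast_last_id prefix_bot.extremum_uniqueI prefix_snoc)
            moreover have "prefix (butlast q) u"
              using pq(2) by (auto simp: Q_def prefixeq_butlast)
            ultimately have "prefix p u" by (rule prefix_order.trans)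
            then have "p = u" using pq(1) by (auto simp: Q_def)
            then have "length u < length q" using \<open>p \<noteq> q\<close> pq(3)
              by (simp add: prefix_length_less strict_prefixI)
            then show False using pq(2) lenQ by force
          qed
        qed (use Q u lenQ in \<open>auto simp: Q_def\<close>)
        moreover have "u \<notin> Q" by (simp add: Q_def)
        ultimately show ?thesis using Q u by (simp add: S_def)
      qed
      \<comment> \<open>A word of \<open>C\<close> stops inside \<open>u\<close>, runs through all
        of \<open>u\<close>, or leaves it by an exit. After \<open>u\<close> the quotient is
        \<open>C\<close> again, which contributes \<open>growth C n\<close>.\<close>
      have upper: "growth C (n + length u) \<le> growth C n + card F * S (n + length u)" for n
      proof -
        let ?m = "n + length u"
        have "growth C ?m \<le> card F + (\<Sum>q\<in>insert u Q. growth (left_quot C q) (?m - length q))"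
        proof (rule growth_le_sum[OF X CX])
          fix w assume w: "w \<in> C"
          show "w \<in> F \<or> (\<exists>q\<in>insert u Q. prefix q w)"
          proof (cases "w \<in> F \<or> prefix u w")
            case False
            then have "w \<parallel> u" by (auto simp: F_def)
            then obtain as b bs c cs where bc: "b \<noteq> c" "w = as @ b # bs" "u = as @ c # cs"
              using parallel_decomp by blast
            then have "as @ [b] \<in> Q" using w C
              by (auto simp: Q_def prefix_closed_def strict_prefix_def)
                (metis append.assoc append_Cons append_Nil)
            moreover have "prefix (as @ [b]) w" using bc by simp
            ultimately show ?thesis by blast
          qed blast
        qed (use Q F in auto)
        also have "\<dots> = card F + growth C n + (\<Sum>q\<in>Q. growth (left_quot C q) (?m - length q))"
          using Q u by (subst sum.insert) (auto simp: Q_def)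
        also have "(\<Sum>q\<in>Q. growth (left_quot C q) (?m - length q))
            \<le> (\<Sum>q\<in>Q. growth (left_quot C q) ?m)"
          using monoD[OF mono_growth[OF X left_quot_lists[OF CX]]] by (intro sum_mono) auto
        \<comment> \<open>Since \<open>card F \<ge> 1\<close>, the constant and the sum together fit
          under \<open>card F * S ?m\<close>.\<close>
        also have "(\<Sum>q\<in>Q. growth (left_quot C q) ?m) \<le> card F * (\<Sum>q\<in>Q. growth (left_quot C q) ?m)"
          using cardF by simp
        finally show ?thesis by (simp add: S_def algebra_simps)
      qed
      have "length u > 0" using u(2) by simp
      from poly_growth_integrate[OF d pos mono this lower upper] show ?thesis by blast
    qed
  qed simp
qed

text \<open>Discrete intermediate values: jumps of size at most \<open>C\<close> cannot skip the
  window of radius \<open>C\<close> around \<open>k\<close>.\<close>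

lemma int_seq_crossing:
  fixes f :: "nat \<Rightarrow> int"
  assumes "m \<le> n" "\<And>i. m \<le> i \<Longrightarrow> i < n \<Longrightarrow> \<bar>f (Suc i) - f i\<bar> \<le> C"
    and "f m \<le> k + C" "k - C \<le> f n"
  shows "\<exists>i\<ge>m. i \<le> n \<and> \<bar>f i - k\<bar> \<le> C"
  using assms
proof (induction n rule: dec_induct)
  case base
  then show ?case by (intro exI[of _ m]) auto
next
  case (step n)
  show ?case
  proof (cases "f (Suc n) \<le> k + C")
    case True
    then show ?thesis using step by (intro exI[of _ "Suc n"]) auto
  next
    case False
    then have "k - C \<le> f n" using step.prems(1)[of n] step.hyps by simp
    then show ?thesis using step by (metis le_SucI less_SucI)
  qed
qed

lemma finite_image_factor:
  assumes "finite (g ` A)" "\<And>x y. x \<in> A \<Longrightarrow> y \<in> A \<Longrightarrow> g x = g y \<Longrightarrow> f x = f y"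
  shows "finite (f ` A)"
proof -
  have "f ` A \<subseteq> (\<lambda>d. f (SOME x. x \<in> A \<and> g x = d)) ` g ` A"
  proof
    fix z assume "z \<in> f ` A"
    then obtain x where x: "x \<in> A" "z = f x" by blast
    have "(SOME y. y \<in> A \<and> g y = g x) \<in> A \<and> g (SOME y. y \<in> A \<and> g y = g x) = g x"
      using someI[of "\<lambda>y. y \<in> A \<and> g y = g x" x] x(1) by simp
    then have "z = f (SOME y. y \<in> A \<and> g y = g x)" using assms(2) x by metis
    then show "z \<in> (\<lambda>d. f (SOME x. x \<in> A \<and> g x = d)) ` g ` A" using x(1) by blast
  qed
  then show ?thesis using assms(1) by (meson finite_imageI finite_subset)
qed

section \<open>Geodesics and cone types\<close>

locale sym_gen_group = group G for G :: "('a, 'b) monoid_scheme" (structure) +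
  fixes X :: "'x set" and ev :: "'x \<Rightarrow> 'a"
  assumes gen: "fin_sym_gen_set G X ev"
begin

abbreviation "val \<equiv> word_eval G ev"
abbreviation "len \<equiv> word_length G X ev"
abbreviation "geo \<equiv> geodesic G X ev"

definition word_dist :: "'a \<Rightarrow> 'a \<Rightarrow> nat" where "word_dist g h = len (inv g \<otimes> h)"

section \<open>Word length and word metric\<close>

lemma finite_X: "finite X" and ev_closed [simp]: "x \<in> X \<Longrightarrow> ev x \<in> carrier G"
  using gen by (auto simp: fin_sym_gen_set_def)

lemma val_Nil [simp]: "val [] = \<one>" and val_Cons [simp]: "val (x # w) = ev x \<otimes> val w"
  by (simp_all add: word_eval_def)

lemma val_closed [simp]: "w \<in> lists X \<Longrightarrow> val w \<in> carrier G"
  by (induction w) auto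

lemma val_append [simp]: "u \<in> lists X \<Longrightarrow> v \<in> lists X \<Longrightarrow> val (u @ v) = val u \<otimes> val v"
  by (induction u) (auto simp: m_assoc)

lemma len_val_le: "w \<in> lists X \<Longrightarrow> len (val w) \<le> length w"
  unfolding word_length_def by (rule Least_le) blast

lemma len_witness:
  assumes "g \<in> carrier G"
  obtains w where "w \<in> lists X" "val w = g" "length w = len g"
proof -
  have "\<exists>n. \<exists>w\<in>lists X. length w = n \<and> val w = g"
    using gen assms unfolding fin_sym_gen_set_def by blast
  from LeastI_ex[OF this] show thesis using that unfolding word_length_def by blast
qed

lemma len_mult: "g \<in> carrier G \<Longrightarrow> h \<in> carrier G \<Longrightarrow> len (g \<otimes> h) \<le> len g + len h"
proof -
  assume "g \<in> carrier G" "h \<in> carrier G"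
  then obtain u v where "u \<in> lists X" "val u = g" "length u = len g"
    "v \<in> lists X" "val v = h" "length v = len h" by (meson len_witness)
  then show ?thesis using len_val_le[of "u @ v"] by simp
qed

lemma len_one [simp]: "len \<one> = 0"
  using len_val_le[of "[]"] by simp

lemma val_inverse: "w \<in> lists X \<Longrightarrow> \<exists>v\<in>lists X. length v = length w \<and> val v = inv (val w)"
proof (induction w)
  case (Cons x w)
  then obtain v where "v \<in> lists X" "length v = length w" "val v = inv (val w)" by auto
  moreover obtain y where "y \<in> X" "ev y = inv (ev x)"
    using gen Cons.prems unfolding fin_sym_gen_set_def by auto
  ultimately show ?case
    using Cons.prems by (intro bexI[of _ "v @ [y]"]) (auto simp: inv_mult_group)
qed simp

lemma len_inv_le: "g \<in> carrier G \<Longrightarrow> len (inv g) \<le> len g"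
  by (metis len_witness len_val_le val_inverse)

lemma len_inv [simp]: "g \<in> carrier G \<Longrightarrow> len (inv g) = len g"
  using len_inv_le[of g] len_inv_le[of "inv g"] by simp

lemma len_ev: "x \<in> X \<Longrightarrow> len (ev x) \<le> 1"
  using len_val_le[of "[x]"] by simp

lemma word_dist_sym: "g \<in> carrier G \<Longrightarrow> h \<in> carrier G \<Longrightarrow> word_dist g h = word_dist h g"
  using len_inv[of "inv g \<otimes> h"] by (simp add: word_dist_def inv_mult_group)

lemma word_dist_triangle:
  assumes "g \<in> carrier G" "h \<in> carrier G" "k \<in> carrier G"
  shows "word_dist g k \<le> word_dist g h + word_dist h k"
proof -
  have "h \<otimes> (inv h \<otimes> k) = k" using assms by (simp add: m_assoc[symmetric])
  then have "inv g \<otimes> k = (inv g \<otimes> h) \<otimes> (inv h \<otimes> k)"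
    using assms by (simp add: m_assoc)
  then show ?thesis using len_mult[of "inv g \<otimes> h" "inv h \<otimes> k"] assms by (simp add: word_dist_def)
qed

lemma word_dist_one: "g \<in> carrier G \<Longrightarrow> word_dist \<one> g = len g"
  by (simp add: word_dist_def)

lemma len_le_word_dist: "g \<in> carrier G \<Longrightarrow> h \<in> carrier G \<Longrightarrow> len h \<le> len g + word_dist g h"
  using word_dist_triangle[of \<one> g h] by (simp add: word_dist_one)

lemma word_dist_le_len: "g \<in> carrier G \<Longrightarrow> h \<in> carrier G \<Longrightarrow> word_dist g h \<le> len g + len h"
  using len_mult[of "inv g" h] by (simp add: word_dist_def)

section \<open>Geodesic words and their factors\<close>

lemma geo_iff: "geo w \<longleftrightarrow> w \<in> lists X \<and> len (val w) = length w"
  by (auto simp: geodesic_def)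

lemma geo_lists: "geo w \<Longrightarrow> w \<in> lists X"
  by (simp add: geodesic_def)

lemma geo_val: "geo w \<Longrightarrow> val w \<in> carrier G" "geo w \<Longrightarrow> len (val w) = length w"
  by (auto simp: geo_iff)

lemma geo_appendD:
  assumes "geo (u @ v)"
  shows "geo u" "geo v"
proof -
  have uv: "u \<in> lists X" "v \<in> lists X" using assms by (auto simp: geo_iff)
  then have "length u + length v \<le> len (val u) + len (val v)"
    using assms len_mult[of "val u" "val v"] by (simp add: geo_iff)
  then show "geo u" "geo v" using uv len_val_le[of u] len_val_le[of v] by (auto simp: geo_iff)
qed

lemma geo_take: "geo w \<Longrightarrow> geo (take i w)" and geo_drop: "geo w \<Longrightarrow> geo (drop i w)"
  by (metis append_take_drop_id geo_appendD)+

lemma len_take: "geo w \<Longrightarrow> i \<le> length w \<Longrightarrow> len (val (take i w)) = i"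
  using geo_val(2)[OF geo_take] by simp

lemma geo_witness:
  assumes "g \<in> carrier G"
  obtains w where "geo w" "val w = g"
  using len_witness[OF assms] by (metis geodesic_def)

lemma finite_ball: "finite {g \<in> carrier G. len g \<le> n}"
proof (rule finite_subset)
  show "{g \<in> carrier G. len g \<le> n} \<subseteq> val ` {w. set w \<subseteq> X \<and> length w \<le> n}"
  proof
    fix g assume "g \<in> {g \<in> carrier G. len g \<le> n}"
    then obtain w where "w \<in> lists X" "val w = g" "length w \<le> n"
      using len_witness by (metis (lifting) mem_Collect_eq)
    then show "g \<in> val ` {w. set w \<subseteq> X \<and> length w \<le> n}" by auto
  qed
  show "finite (val ` {w. set w \<subseteq> X \<and> length w \<le> n})"
    using finite_X by (intro finite_imageI finite_lists_length_le)
qed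

text \<open>The geodesics end at adjacent elements. They are compared at times differing by one,
  because Cannon's argument needs a point on \<open>v\<close> strictly closer to the identity than
  the one on \<open>w\<close>.\<close>

definition fellow_travel :: "nat \<Rightarrow> bool" where
  "fellow_travel N \<longleftrightarrow> (\<forall>w v x i j. geo w \<longrightarrow> geo v \<longrightarrow> x \<in> X \<longrightarrow> val v = val w \<otimes> ev x \<longrightarrow>
     i \<le> length w \<longrightarrow> j \<le> length v \<longrightarrow> i = Suc j \<longrightarrow> word_dist (val (take i w)) (val (take j v)) \<le> N)"

text \<open>The finite local datum that determines the cone type of \<open>g\<close> in Cannon's
  argument.\<close>

definition descents :: "nat \<Rightarrow> 'a \<Rightarrow> 'a set" where
  "descents N g = {h \<in> carrier G. len h \<le> N \<and> len (g \<otimes> h) < len g}"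

lemma fellow_travel_mono: "fellow_travel M \<Longrightarrow> M \<le> N \<Longrightarrow> fellow_travel N"
  unfolding fellow_travel_def using le_trans by blast

text \<open>Cannon's argument: a shorter path to \<open>q @ u @ [x]\<close> passes, just before reaching the
  length of \<open>q\<close>, through a descent of \<open>q\<close>, which is also a descent of \<open>p\<close> and so gives a shortcut
  to \<open>p @ u @ [x]\<close>.\<close>

lemma cone_type_subset:
  assumes N: "fellow_travel N" "N \<ge> 1"
    and p: "geo p" "geo q" "descents N (val p) = descents N (val q)"
  shows "geo (p @ u) \<Longrightarrow> geo (q @ u)"
proof (induction u rule: rev_induct)
  case Nil
  then show ?case using p by simp
next
  case (snoc x u)
  let ?g = "val p" and ?h = "val q"
  have pu: "geo (p @ u)" using geo_appendD(1)[of "p @ u" "[x]"] snoc.prems by simp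
  then have qu: "geo (q @ u)" by (rule snoc.IH)
  have X: "p \<in> lists X" "q \<in> lists X" "u \<in> lists X" "x \<in> X"
    using geo_lists[OF snoc.prems] geo_lists[OF qu] by auto
  note [simp] = X val_closed[OF X(1)] val_closed[OF X(2)] val_closed[OF X(3)] ev_closed[OF X(4)]
  show ?case
  proof (rule ccontr)
    assume not_geo: "\<not> geo (q @ u @ [x])"
    \<comment> \<open>The identity has no descents, whereas a nonempty geodesic \<open>p\<close> has
      the inverse of its last letter as a descent; this is where \<open>N \<ge> 1\<close>
      enters.\<close>
    have "q \<noteq> []"
    proof
      assume q: "q = []"
      then have "p \<noteq> []" using not_geo snoc.prems by auto
      then obtain r y where r: "p = r @ [y]" by (metis rev_exhaust)
      then have ry: "r \<in> lists X" "y \<in> X" using X by auto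
      then have "?g \<otimes> inv (ev y) = val r" by (simp add: r m_assoc)
      moreover have "len (val r) < len ?g" using len_val_le[OF ry(1)] geo_val(2)[OF p(1)] r by simp
      moreover have "len (inv (ev y)) \<le> N" using len_ev[OF ry(2)] N(2) ry(2) by simp
      ultimately have "inv (ev y) \<in> descents N ?h"
        using p(3)[symmetric] ry(2) by (simp add: descents_def)
      then show False using q by (simp add: descents_def)
    qed
    then obtain j where j: "length q = Suc j" by (cases q) auto
    obtain v where v: "geo v" "val v = val (q @ u) \<otimes> ev x"
      using geo_witness[of "val (q @ u) \<otimes> ev x"] by auto
    have vX: "v \<in> lists X" using v(1) by (rule geo_lists)
    have v_short: "length v \<le> length q + length u"
      using not_geo len_val_le[of "q @ u @ [x]"] geo_val(2)[OF v(1)] v(2)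
      by (auto simp: geo_iff m_assoc)
    have "val (q @ u) = val v \<otimes> inv (ev x)" using v(2) by (simp add: m_assoc)
    then have "length (q @ u) \<le> length v + len (inv (ev x))"
      using len_mult[of "val v" "inv (ev x)"] geo_val(2)[OF qu] geo_val[OF v(1)] by simp
    \<comment> \<open>\<open>v\<close> is at most one letter shorter than \<open>q @ u\<close>, so
      its prefix \<open>take j v\<close> really has length \<open>j\<close>.\<close>
    then have jv: "j \<le> length v" using len_ev[OF X(4)] j by simp
    define y z where "y = take j v" and "z = drop j v"
    have yz: "y \<in> lists X" "z \<in> lists X" "val v = val y \<otimes> val z"
      using geo_lists[OF geo_take[OF v(1)]] geo_lists[OF geo_drop[OF v(1)]]
        val_append[of y z] by (auto simp: y_def z_def)
    note [simp] = val_closed[OF yz(1)] val_closed[OF yz(2)]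
    \<comment> \<open>\<open>h\<close> leads from the end of \<open>q\<close> to the point of
      \<open>v\<close> at time \<open>length q - 1\<close>. Fellow travelling bounds its length, and
      that point is closer to the identity, so \<open>h\<close> is a descent.\<close>
    define h where "h = inv ?h \<otimes> val y"
    have h [simp]: "h \<in> carrier G" by (simp add: h_def)
    have "word_dist (val (take (Suc j) (q @ u))) (val (take j v)) \<le> N"
      using N(1)[unfolded fellow_travel_def, rule_format, OF qu v(1) X(4) v(2) _ jv refl] j by simp
    then have "len h \<le> N" using j by (simp add: h_def y_def word_dist_def)
    moreover have hy: "?h \<otimes> h = val y" by (simp add: h_def m_assoc[symmetric])
    moreover have "len (val y) < len ?h"
      using len_val_le[OF yz(1)] geo_val(2)[OF p(2)] j jv by (simp add: y_def)
    ultimately have "h \<in> descents N ?g" using p(3) by (simp add: descents_def)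
    then have gh: "len (?g \<otimes> h) < length p" using geo_val(2)[OF p(1)] by (simp add: descents_def)
    \<comment> \<open>The path through \<open>?g \<otimes> h\<close> followed by \<open>z\<close> is
      the shortcut: the first part has length below \<open>length p\<close>, the second at most
      \<open>length u + 1\<close>.\<close>
    have "h \<otimes> val z = inv ?h \<otimes> val v" by (simp add: h_def yz(3) m_assoc)
    also have "\<dots> = val u \<otimes> ev x" by (simp add: v(2) m_assoc inv_solve_left')
    finally have "val (p @ u @ [x]) = (?g \<otimes> h) \<otimes> val z" by (simp add: m_assoc)
    then have "length (p @ u @ [x]) \<le> len (?g \<otimes> h) + len (val z)"
      using geo_val(2)[OF snoc.prems] len_mult[of "?g \<otimes> h" "val z"] by simp
    moreover have "len (val z) \<le> length u + 1"
      using len_val_le[OF yz(2)] v_short j by (simp add: z_def)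
    ultimately show False using gh by simp
  qed
qed

lemma finite_cone_types:
  assumes "fellow_travel N" "N \<ge> 1"
  shows "finite (left_quots (Collect geo))"
  unfolding left_quots_def
proof (rule finite_image_factor[of "\<lambda>w. descents N (val w)"])
  have "(\<lambda>w. descents N (val w)) ` Collect geo \<subseteq> Pow {g \<in> carrier G. len g \<le> N}"
    by (auto simp: descents_def)
  then show "finite ((\<lambda>w. descents N (val w)) ` Collect geo)"
    using finite_ball by (meson finite_Pow_iff finite_subset)
  fix p q assume "p \<in> Collect geo" "q \<in> Collect geo" "descents N (val p) = descents N (val q)"
  then show "left_quot (Collect geo) p = left_quot (Collect geo) q"
    using cone_type_subset[OF assms, of p q] cone_type_subset[OF assms, of q p]
    by (auto simp: left_quot_def)
qed

lemma fellow_travel_finite: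
  assumes "finite (carrier G)"
  shows "\<exists>N. fellow_travel N"
proof -
  have "word_dist (val (take i w)) (val (take j v)) \<le> Max (len ` carrier G)" if "geo w" "geo v" for i j w v
    unfolding word_dist_def using that assms geo_val(1)[OF geo_take] by (intro Max_ge) auto
  then show ?thesis unfolding fellow_travel_def by blast
qed

section \<open>Fellow travelling in virtually cyclic groups\<close>

text \<open>A coordinate on a virtually infinite cyclic group: \<open>g = t [^] \<phi> g \<otimes> r\<close> with \<open>r\<close>
  from a finite set.\<close>

lemma coarse_coordinate:
  assumes t: "t \<in> carrier G" "inj (\<lambda>k::int. t [^] k)"
    and R: "finite R" "R \<subseteq> carrier G" "\<And>g. g \<in> carrier G \<Longrightarrow> \<exists>k::int. \<exists>r\<in>R. g = t [^] k \<otimes> r"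
  obtains \<phi> :: "'a \<Rightarrow> int" and C :: nat where
    "\<And>g x. g \<in> carrier G \<Longrightarrow> x \<in> X \<Longrightarrow> \<bar>\<phi> (g \<otimes> ev x) - \<phi> g\<bar> \<le> int C"
    "\<And>k. \<bar>\<phi> (t [^] k) - k\<bar> \<le> int C"
    "\<And>g. g \<in> carrier G \<Longrightarrow> word_dist (t [^] \<phi> g) g \<le> C"
proof -
  obtain \<phi> :: "'a \<Rightarrow> int" and r where \<phi>: "\<And>g. g \<in> carrier G \<Longrightarrow> r g \<in> R \<and> g = t [^] \<phi> g \<otimes> r g"
    using R(3) by metis
  \<comment> \<open>A step along a letter changes the power of \<open>t\<close> by some
    \<open>s \<otimes> ev x \<otimes> inv s'\<close>; comparing \<open>t [^] k\<close> with its own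
    coordinate gives an element of \<open>R\<close>. Only finitely many exponents give such
    elements, as \<open>t\<close> has distinct powers.\<close>
  define F where "F = R \<union> (\<lambda>(s, x, s'). s \<otimes> ev x \<otimes> inv s') ` (R \<times> X \<times> R)"
  define M where "M = (\<lambda>k::int. t [^] k) -` F"
  have "finite M" unfolding M_def F_def using R(1) finite_X t(2) by (intro finite_vimageI) auto
  define C where "C = Max (insert 0 (nat ` abs ` M \<union> len ` R))"
  have M: "\<bar>k\<bar> \<le> int C" if "k \<in> M" for k
  proof -
    have "nat \<bar>k\<bar> \<le> C" unfolding C_def using that \<open>finite M\<close> R(1) by (intro Max_ge) auto
    then show ?thesis by simp
  qed
  have R': "len s \<le> C" if "s \<in> R" for s
    unfolding C_def using that \<open>finite M\<close> R(1) by (intro Max_ge) auto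
  have r: "r g \<in> R" "r g \<in> carrier G" "inv (t [^] \<phi> g) \<otimes> g = r g" if "g \<in> carrier G" for g
  proof -
    show "r g \<in> R" using \<phi>[OF that] by simp
    then show "r g \<in> carrier G" using R(2) by blast
    then show "inv (t [^] \<phi> g) \<otimes> g = r g" using \<phi>[OF that] t(1) that by (simp add: inv_solve_left')
  qed
  show thesis
  proof
    fix g assume g: "g \<in> carrier G"
    show "word_dist (t [^] \<phi> g) g \<le> C" using R' r[OF g] by (simp add: word_dist_def)
    fix x assume x: "x \<in> X"
    let ?h = "g \<otimes> ev x"
    have h: "?h \<in> carrier G" using g x by simp
    have "t [^] (- \<phi> g + \<phi> ?h) = inv (t [^] \<phi> g) \<otimes> t [^] \<phi> ?h"
      using t(1) by (simp only: int_pow_mult int_pow_neg)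
    also have "t [^] \<phi> ?h = ?h \<otimes> inv (r ?h)"
      using \<phi>[OF h] r(2)[OF h] h t(1) by (metis int_pow_closed inv_solve_right)
    also have "inv (t [^] \<phi> g) \<otimes> (?h \<otimes> inv (r ?h)) = (inv (t [^] \<phi> g) \<otimes> g) \<otimes> ev x \<otimes> inv (r ?h)"
      using g x t(1) r(2)[OF h] by (simp add: m_assoc)
    also have "\<dots> = r g \<otimes> ev x \<otimes> inv (r ?h)" by (simp add: r(3)[OF g])
    also have "\<dots> \<in> F" unfolding F_def using r(1)[OF g] r(1)[OF h] x by force
    finally have "- \<phi> g + \<phi> ?h \<in> M" by (simp add: M_def)
    then show "\<bar>\<phi> ?h - \<phi> g\<bar> \<le> int C" using M by fastforce
  next
    fix k :: int
    let ?g = "t [^] k"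
    have g: "?g \<in> carrier G" using t(1) by (rule int_pow_closed)
    have "t [^] (- \<phi> ?g + k) = inv (t [^] \<phi> ?g) \<otimes> t [^] k"
      using t(1) by (simp only: int_pow_mult int_pow_neg)
    also have "\<dots> = r ?g" using r(3)[OF g] .
    also have "\<dots> \<in> F" using r(1)[OF g] by (simp add: F_def)
    finally have "- \<phi> ?g + k \<in> M" by (simp add: M_def)
    then show "\<bar>\<phi> ?g - k\<bar> \<le> int C" using M[of "- \<phi> ?g + k"] by simp
  qed
qed

text \<open>On one side of the origin, distance is bounded by the difference of lengths plus a
  constant, so points at almost equal times are close. Points on opposite sides occur only near the
  identity, since one of the two geodesics must come back past it.\<close>

lemma fellow_travel_infinite_order:
  assumes t: "t \<in> carrier G" "inj (\<lambda>k::int. t [^] k)"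
    and R: "finite R" "R \<subseteq> carrier G" "\<And>g. g \<in> carrier G \<Longrightarrow> \<exists>k::int. \<exists>r\<in>R. g = t [^] k \<otimes> r"
  shows "\<exists>N. fellow_travel N"
proof -
  obtain \<phi> :: "'a \<Rightarrow> int" and C :: nat where
    \<phi>_step: "\<And>g x. g \<in> carrier G \<Longrightarrow> x \<in> X \<Longrightarrow> \<bar>\<phi> (g \<otimes> ev x) - \<phi> g\<bar> \<le> int C" and
    \<phi>_pow: "\<And>k. \<bar>\<phi> (t [^] k) - k\<bar> \<le> int C" and
    near_axis: "\<And>g. g \<in> carrier G \<Longrightarrow> word_dist (t [^] \<phi> g) g \<le> C"
    using coarse_coordinate[OF t R] by blast
  \<comment> \<open>\<open>E\<close> bounds the cost of moving the exponent by at most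
    \<open>C\<close>, and a further \<open>C\<close> leads from the axis to the element.\<close>
  define E where "E = Max ((\<lambda>e. len (t [^] e)) ` {- int C..int C})"
  define N where "N = E + C"
  have pow [simp]: "t [^] k \<in> carrier G" for k :: int using t(1) by simp
  have word_dist_pow: "word_dist (t [^] a) (t [^] b) = len (t [^] (b - a))" for a b :: int
    using t(1) int_pow_mult[OF t(1), of "- a" b] by (simp add: word_dist_def int_pow_neg)
  have near: "word_dist (t [^] k) g \<le> N" if "g \<in> carrier G" "\<bar>\<phi> g - k\<bar> \<le> int C" for g k
  proof -
    have "len (t [^] (\<phi> g - k)) \<le> E"
      unfolding E_def using that(2) by (intro Max_ge imageI finite_imageI) (auto simp: abs_le_iff)
    then show ?thesis
      using word_dist_triangle[of "t [^] k" "t [^] \<phi> g" g] near_axis[OF that(1)] that(1)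
      by (simp add: word_dist_pow N_def)
  qed
  \<comment> \<open>The coordinate moves by jumps of at most \<open>C\<close> and has to cross
    \<open>k\<close>; the downward case is the upward one after negation.\<close>
  have pass: "\<exists>i\<ge>m. i \<le> length w \<and> word_dist (t [^] k) (val (take i w)) \<le> N"
    if w: "geo w" "m \<le> length w"
      and k: "(\<phi> (val (take m w)) \<le> k + int C \<and> k - int C \<le> \<phi> (val w)) \<or>
        (k - int C \<le> \<phi> (val (take m w)) \<and> \<phi> (val w) \<le> k + int C)" for w m k
  proof -
    let ?f = "\<lambda>i. \<phi> (val (take i w))"
    have step: "\<bar>?f (Suc i) - ?f i\<bar> \<le> int C" if "i < length w" for i
      using geo_lists[OF geo_take[OF w(1), of i]] geo_lists[OF w(1)] that \<phi>_step
      by (auto simp: take_Suc_conv_app_nth in_lists_conv_set)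
    have "\<exists>i\<ge>m. i \<le> length w \<and> \<bar>?f i - k\<bar> \<le> int C"
      using k
    proof
      assume "?f m \<le> k + int C \<and> k - int C \<le> \<phi> (val w)"
      then show ?thesis using step w(2) by (intro int_seq_crossing) auto
    next
      assume "k - int C \<le> ?f m \<and> \<phi> (val w) \<le> k + int C"
      then have "\<exists>i\<ge>m. i \<le> length w \<and> \<bar>- ?f i - (- k)\<bar> \<le> int C"
        using step w(2) by (intro int_seq_crossing) (auto simp: abs_minus_commute)
      then show ?thesis by (simp add: abs_minus_commute)
    qed
    then show ?thesis using near geo_val(1)[OF geo_take[OF w(1)]] by blast
  qed
  \<comment> \<open>A geodesic to \<open>t [^] b\<close> passes within \<open>N\<close> of
    \<open>t [^] a\<close>; splitting it there costs \<open>N\<close> for each of the two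
    parts.\<close>
  have superadd: "len (t [^] a) + word_dist (t [^] a) (t [^] b) \<le> len (t [^] b) + 2 * N"
    if ab: "(0 \<le> a \<and> a \<le> b) \<or> (b \<le> a \<and> a \<le> 0)" for a b :: int
  proof -
    obtain w where w: "geo w" "val w = t [^] b" using geo_witness[OF pow[of b]] by blast
    have "\<bar>\<phi> \<one>\<bar> \<le> int C" using \<phi>_pow[of 0] by simp
    then obtain i where i: "i \<le> length w" "word_dist (t [^] a) (val (take i w)) \<le> N"
      using pass[OF w(1), of 0 a] \<phi>_pow[of b] ab w(2) by (auto simp: abs_le_iff)
    let ?g = "val (take i w)"
    have g: "?g \<in> carrier G" "len ?g = i" using geo_val(1)[OF geo_take[OF w(1)]] len_take[OF w(1) i(1)] .
    have drop: "drop i w \<in> lists X" using geo_lists[OF geo_drop[OF w(1)]] .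
    have "val w = ?g \<otimes> val (drop i w)"
      using val_append[OF geo_lists[OF geo_take[OF w(1), of i]] drop] by simp
    then have "inv ?g \<otimes> t [^] b = val (drop i w)"
      using w(2) g(1) val_closed[OF drop] by (simp add: inv_solve_left')
    then have "word_dist ?g (t [^] b) \<le> length w - i" using len_val_le[OF drop] by (simp add: word_dist_def)
    moreover have "word_dist (t [^] a) (t [^] b) \<le> word_dist (t [^] a) ?g + word_dist ?g (t [^] b)"
      using g(1) by (intro word_dist_triangle) auto
    moreover have "len (t [^] a) \<le> i + word_dist (t [^] a) ?g"
      using len_le_word_dist[of ?g "t [^] a"] word_dist_sym[of ?g "t [^] a"] g by simp
    moreover have "length w = len (t [^] b)" using geo_val(2)[OF w(1)] w(2) by simp
    ultimately show ?thesis using i by simp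
  qed
  \<comment> \<open>Replacing \<open>P\<close> and \<open>Q\<close> by powers of \<open>t\<close>
    costs \<open>N\<close> four times, twice in the distance and once in each length, on top of the
    \<open>2 * N\<close> from \<open>superadd\<close>.\<close>
  have same_side: "word_dist P Q + len P \<le> 6 * N + len Q"
    if P: "P \<in> carrier G" "Q \<in> carrier G"
      and ab: "(0 \<le> \<phi> P \<and> \<phi> P \<le> \<phi> Q) \<or> (\<phi> Q \<le> \<phi> P \<and> \<phi> P \<le> 0)" for P Q
  proof -
    let ?p = "t [^] \<phi> P" and ?q = "t [^] \<phi> Q"
    have n: "word_dist ?p P \<le> N" "word_dist ?q Q \<le> N" using near P by simp_all
    have "word_dist P Q \<le> word_dist P ?p + (word_dist ?p ?q + word_dist ?q Q)"
      using word_dist_triangle[of P ?p Q] word_dist_triangle[of ?p ?q Q] P by simp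
    moreover have "len P \<le> len ?p + word_dist ?p P" "len ?q \<le> len Q + word_dist Q ?q"
      using P len_le_word_dist by simp_all
    moreover have "word_dist P ?p = word_dist ?p P" "word_dist Q ?q = word_dist ?q Q" using P word_dist_sym by simp_all
    ultimately show ?thesis using superadd[OF ab] n by simp
  qed
  have close: "word_dist (val (take i w)) (val (take j v)) \<le> 6 * N + 1"
    if w: "geo w" "i \<le> length w" and v: "geo v" "j \<le> length v"
      and ends: "\<bar>\<phi> (val w) - \<phi> (val v)\<bar> \<le> int C" and ij: "i \<le> j + 1" "j \<le> i + 1"
      and le: "\<phi> (val (take i w)) \<le> \<phi> (val (take j v))" for w v i j
  proof -
    let ?P = "val (take i w)" and ?Q = "val (take j v)"
    have P: "?P \<in> carrier G" "len ?P = i" using geo_val(1)[OF geo_take[OF w(1)]] len_take[OF w] .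
    have Q: "?Q \<in> carrier G" "len ?Q = j" using geo_val(1)[OF geo_take[OF v(1)]] len_take[OF v] .
    consider "0 \<le> \<phi> ?P" | "\<phi> ?Q \<le> 0" | "\<phi> ?P < 0" "0 < \<phi> ?Q" by linarith
    then show ?thesis
    proof cases
      case 1
      then show ?thesis using same_side[of ?P ?Q] P Q le ij by simp
    next
      case 2
      then show ?thesis using same_side[of ?Q ?P] P Q le ij word_dist_sym[of ?P ?Q] by simp
    next
      case 3
      \<comment> \<open>The endpoints have nearly equal coordinates, so either \<open>w\<close>
        returns from the negative side or \<open>v\<close> from the positive side. It then passes
        within \<open>N\<close> of the identity at a later time, which bounds the present time by
        \<open>N\<close>.\<close>
      have "i \<le> N \<or> j \<le> N"
      proof (cases "\<phi> (val w) \<ge> 0")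
        case True
        then obtain s where "s \<ge> i" "s \<le> length w" "word_dist (t [^] (0::int)) (val (take s w)) \<le> N"
          using pass[OF w, of 0] 3 by auto
        then show ?thesis
          using len_take[OF w(1)] geo_val(1)[OF geo_take[OF w(1)]] by (simp add: word_dist_one)
      next
        case False
        then have "\<phi> (val v) \<le> int C" using ends by linarith
        then obtain s where "s \<ge> j" "s \<le> length v" "word_dist (t [^] (0::int)) (val (take s v)) \<le> N"
          using pass[OF v, of 0] 3 by auto
        then show ?thesis
          using len_take[OF v(1)] geo_val(1)[OF geo_take[OF v(1)]] by (simp add: word_dist_one)
      qed
      then have "i + j \<le> 6 * N + 1" using ij by auto
      then show ?thesis using word_dist_le_len[OF P(1) Q(1)] P Q by simp
    qed
  qed
  have "fellow_travel (6 * N + 1)"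
    unfolding fellow_travel_def
  proof (intro allI impI)
    fix w v x i j
    assume w: "geo w" "i \<le> length w" and v: "geo v" "j \<le> length v" and x: "x \<in> X"
      and vw: "val v = val w \<otimes> ev x" and ij: "i = Suc j"
    let ?P = "val (take i w)" and ?Q = "val (take j v)"
    have PQ: "?P \<in> carrier G" "?Q \<in> carrier G"
      using geo_val(1)[OF geo_take[OF w(1)]] geo_val(1)[OF geo_take[OF v(1)]] .
    have ends: "\<bar>\<phi> (val v) - \<phi> (val w)\<bar> \<le> int C"
      using \<phi>_step[OF geo_val(1)[OF w(1)] x] vw by simp
    show "word_dist ?P ?Q \<le> 6 * N + 1"
    proof (cases "\<phi> ?P \<le> \<phi> ?Q")
      case True
      then show ?thesis using close[OF w v] ends ij by (simp add: abs_minus_commute)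
    next
      case False
      then show ?thesis using close[OF v w ends] ij word_dist_sym[OF PQ] by simp
    qed
  qed
  then show ?thesis ..
qed

text \<open>If the powers of \<open>t\<close> are distinct, coset representatives serve as the
  finite set \<open>R\<close>. Otherwise the cyclic subgroup is finite, and so is \<open>G\<close>,
  as a union of finitely many finite cosets.\<close>

lemma fellow_travel_virtually_cyclic:
  assumes "virtually_cyclic G"
  shows "\<exists>N. fellow_travel N"
proof -
  obtain t where t: "t \<in> carrier G" and fin: "finite (rcosets (generate G {t}))"
    using assms unfolding virtually_cyclic_def by blast
  define H where "H = generate G {t}"
  have H: "subgroup H G" unfolding H_def using t by (intro generate_is_subgroup) simp
  have H_pow: "H = range (\<lambda>k::int. t [^] k)" unfolding H_def using generate_pow[OF t] by auto
  show ?thesis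
  proof (cases "inj (\<lambda>k::int. t [^] k)")
    case True
    obtain R where R: "finite R" "R \<subseteq> carrier G" "rcosets H = (\<lambda>a. H #> a) ` R"
      using finite_subset_image[of "rcosets H" "\<lambda>a. H #> a" "carrier G"] fin
      unfolding H_def RCOSETS_def UNION_singleton_eq_range by blast
    have "\<exists>k::int. \<exists>r\<in>R. g = t [^] k \<otimes> r" if g: "g \<in> carrier G" for g
    proof -
      have "H #> g \<in> (\<lambda>a. H #> a) ` R" using g R(3) by (auto simp: RCOSETS_def)
      then obtain r where "r \<in> R" "H #> g = H #> r" by blast
      moreover have "g \<in> H #> g" using rcos_self[OF g H] .
      ultimately show ?thesis by (auto simp: r_coset_def H_pow)
    qed
    then show ?thesis using fellow_travel_infinite_order[OF t True R(1,2)] by blast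
  next
    case False
    then obtain a b :: int where ab: "a < b" "t [^] a = t [^] b"
      by (metis injI linorder_neqE_linordered_idom)
    define n where "n = b - a"
    have n: "n > 0" "t [^] n = \<one>" using ab t by (auto simp: n_def int_pow_diff)
    have "t [^] k = t [^] (k mod n)" for k :: int
    proof -
      have "t [^] k = t [^] (n * (k div n) + k mod n)" by simp
      also have "\<dots> = t [^] (n * (k div n)) \<otimes> t [^] (k mod n)" by (rule int_pow_mult[OF t])
      also have "t [^] (n * (k div n)) = (t [^] n) [^] (k div n)" using int_pow_pow[OF t] by simp
      finally show ?thesis using n(2) t by simp
    qed
    then have "H \<subseteq> (\<lambda>k. t [^] k) ` {0..<n}"
      unfolding H_pow using n(1) by (metis (no_types, lifting) atLeastLessThan_iff image_eqI
          image_subsetI pos_mod_bound pos_mod_sign)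
    then have "finite H" by (meson finite_atLeastLessThan_int finite_imageI finite_subset)
    then have "finite (\<Union>a\<in>carrier G. H #> a)"
      using fin unfolding H_def[symmetric] RCOSETS_def UNION_singleton_eq_range
      by (intro finite_Union[of "(\<lambda>a. H #> a) ` carrier G"]) (auto simp: r_coset_def)
    moreover have "carrier G \<subseteq> (\<Union>a\<in>carrier G. H #> a)" using rcos_self[OF _ H] by blast
    ultimately show ?thesis using fellow_travel_finite finite_subset by blast
  qed
qed

section \<open>The language of geodesics and its submultiplicative growth\<close>

lemma geodesic_growth_eq: "geodesic_growth G X ev = growth (Collect geo)"
  by (simp add: fun_eq_iff geodesic_growth_def growth_def)

lemma geo_subset: "Collect geo \<subseteq> lists X"
  using geo_lists by blast

lemma prefix_closed_geo: "prefix_closed (Collect geo)"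
  unfolding prefix_closed_def using geo_appendD(1) by (auto simp: geo_iff)

text \<open>Cutting a geodesic after at most \<open>m\<close> letters yields two geodesic factors,
  and the pair determines the word.\<close>

lemma growth_geo_submult:
  "growth (Collect geo) (m + n) \<le> growth (Collect geo) m * growth (Collect geo) n"
proof -
  let ?B = "\<lambda>n. {w \<in> Collect geo. length w \<le> n}"
  have fin: "finite (?B n)" for n by (rule finite_short_words[OF finite_X geo_subset])
  have "?B (m + n) \<subseteq> (\<lambda>(u, v). u @ v) ` (?B m \<times> ?B n)"
  proof
    fix w assume "w \<in> ?B (m + n)"
    then have "take m w \<in> ?B m" "drop m w \<in> ?B n" using geo_take geo_drop by auto
    then show "w \<in> (\<lambda>(u, v). u @ v) ` (?B m \<times> ?B n)"
      by (intro image_eqI[of _ _ "(take m w, drop m w)"]) auto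
  qed
  then have "card (?B (m + n)) \<le> card (?B m \<times> ?B n)"
    using fin by (meson card_image_le card_mono finite_SigmaI finite_imageI le_trans)
  then show ?thesis by (simp add: growth_def card_cartesian_product)
qed

end

lemma submult_le_power:
  fixes f :: "nat \<Rightarrow> nat"
  assumes "\<And>m n. f (m + n) \<le> f m * f n" "f 0 = 1"
  shows "f (k * n) \<le> f n ^ k"
proof (induction k)
  case (Suc k)
  have "f (Suc k * n) \<le> f n * f (k * n)" using assms(1)[of n "k * n"] by simp
  also have "\<dots> \<le> f n * f n ^ k" using Suc.IH by (rule mult_left_mono) simp
  finally show ?case by simp
qed (simp add: assms(2))

text \<open>If \<open>f n < b ^ n\<close> for some \<open>n\<close>, submultiplicativity along the
  multiples of \<open>n\<close> gives \<open>c \<le> (f n / b ^ n) ^ k\<close> for all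
  \<open>k\<close>, although the right side tends to 0.\<close>

lemma exp_lower_bound_submult:
  fixes f :: "nat \<Rightarrow> nat" and c b :: real
  assumes submult: "\<And>m n. f (m + n) \<le> f m * f n" and c: "c > 0" "b > 0" "\<And>n. c * b ^ n \<le> real (f n)"
    and f0: "f 0 = 1"
  shows "b ^ n \<le> real (f n)"
proof (rule ccontr)
  assume "\<not> b ^ n \<le> real (f n)"
  then have q: "real (f n) / b ^ n < 1" using c(2) by simp
  have pow: "f (k * n) \<le> f n ^ k" for k
    using submult f0 by (rule submult_le_power)
  have "c \<le> (real (f n) / b ^ n) ^ k" for k
  proof -
    have "c * b ^ (k * n) \<le> real (f n ^ k)" using c(3)[of "k * n"] pow[of k]
      by (meson of_nat_le_iff order_trans)
    then show ?thesis using c(2)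
      by (simp add: power_divide pos_le_divide_eq power_mult[symmetric] mult.commute)
  qed
  moreover obtain k where "(real (f n) / b ^ n) ^ k < c"
    using real_arch_pow_inv[OF c(1) q] by blast
  ultimately show False by (meson not_less)
qed

theorem theorem1p2:
  fixes G :: "('a, 'b) monoid_scheme" and X :: "'x set" and ev :: "'x \<Rightarrow> 'a"
  assumes "group G" and "virtually_cyclic G" and "fin_sym_gen_set G X ev"
  shows "(\<exists>b B::real. 1 < b \<and> b \<le> B \<and>
            (\<forall>n. b ^ n \<le> real (geodesic_growth G X ev n) \<and> real (geodesic_growth G X ev n) \<le> B ^ n))
       \<or> (\<exists>p q :: real poly. degree p = degree q \<and> lead_coeff p > 0 \<and>
            (\<forall>n. poly p (real n) \<le> real (geodesic_growth G X ev n)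
                 \<and> real (geodesic_growth G X ev n) \<le> poly q (real n)))"
proof -
  interpret sym_gen_group G X ev
    using assms by (simp add: sym_gen_group_def sym_gen_group_axioms_def)
  let ?f = "geodesic_growth G X ev"
  obtain N where "fellow_travel N" using fellow_travel_virtually_cyclic[OF assms(2)] by blast
  then have "fellow_travel (Suc N)" by (rule fellow_travel_mono) simp
  then have "finite (left_quots (Collect geo))" by (intro finite_cone_types[of "Suc N"]) auto
  then consider "exp_growth ?f" | k where "poly_growth k ?f"
    using growth_dichotomy[OF finite_X geo_subset prefix_closed_geo]
    unfolding geodesic_growth_eq by blast
  then show ?thesis
  proof cases
    case 1
    then obtain c b :: real where c: "c > 0" "b > 1" "\<And>n. c * b ^ n \<le> real (?f n)"
      unfolding exp_growth_def by blast
    have submult: "?f (m + n) \<le> ?f m * ?f n" for m n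
      unfolding geodesic_growth_eq by (rule growth_geo_submult)
    have "{w. geo w \<and> length w \<le> 0} = {[]}"
      using prefix_closed_geo by (auto simp: prefix_closed_def)
    then have f0: "?f 0 = 1" by (simp add: geodesic_growth_def)
    have lower: "b ^ n \<le> real (?f n)" for n
      by (rule exp_lower_bound_submult[OF submult c(1) _ c(3) f0]) (use c(2) in simp)
    \<comment> \<open>The upper base is \<open>?f 1\<close>, by submultiplicativity in steps of
      length one.\<close>
    have "real (?f n) \<le> real (?f 1) ^ n" for n
      using submult_le_power[OF submult f0, of n 1] by (metis mult.right_neutral of_nat_le_iff of_nat_power)
    moreover have "b \<le> real (?f 1)" using lower[of 1] by simp
    ultimately show ?thesis using lower c(2) by blast
  next
    case 2
    then obtain c K :: real where c: "c > 0" "K > 0" "\<And>n. c * real (n + 1) ^ k \<le> real (?f n)"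
      "\<And>n. real (?f n) \<le> K * real (n + 1) ^ k" by (rule poly_growth_bounds) blast
    \<comment> \<open>The bounds in powers of \<open>n + 1\<close> become polynomials
      \<open>a * (1 + x) ^ k\<close>, whose degree is the same for both constants.\<close>
    define P :: "real \<Rightarrow> real poly" where "P a = smult a ([:1, 1:] ^ k)" for a
    have P: "degree (P a) = k" "lead_coeff (P a) = a" if "a > 0" for a
      using that by (simp add: P_def degree_power_eq)
        (simp only: P_def lead_coeff_smult lead_coeff_power, simp)
    have eval: "poly (P a) (real n) = a * real (n + 1) ^ k" for a n
      by (simp add: P_def add.commute)
    have "degree (P c) = degree (P K)" "lead_coeff (P c) > 0"
      using P c(1,2) by simp_all
    then show ?thesis using c(3,4) unfolding eval[symmetric] by blast
  qed
qed

end
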